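(* Let $r>0$, $x_0,\hat{x}\in\mathbb{R}$, and let $v$ be a measure on $(0,\infty)$ with $M_k:=\int_0^{+\infty} z^k\,v(\mathrm{d}z)<+\infty$ for $k=1,2$. Let $(X_t^* )_{0\le t<1}$ be the process with $X_0^*=x_0$ solving $$\mathrm{d}X_t^*=\left(-(r+A_t)X_t^*-B_t+M_1\right)\mathrm{d}t+\int_0^{+\infty} z\,\tilde{N}(\mathrm{d}z,\mathrm{d}t),\qquad 0\le t<1,$$ where $\tilde N$ is the compensated Poisson random measure with compensator $v(\mathrm{d}z)\,\mathrm{d}t$ and $$A_t=\frac{2r}{\exp(2r(1-t))-1},\qquad B_t=\frac{2r\left(-\hat{x}+\frac{M_1}{r}\left(1-\exp(-r(1-t))\right)\right)}{\exp(r(1-t))\left(1-\exp(-2r(1-t))\right)},\qquad 0\le t<1.$$ Then $$\lim_{t\to 1-}X_t^*=\hat{x}\quad\text{almost surely.}$$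
   Context: All processes live on a probability space $(\Omega,\mathcal{F},\mathbb{P})$. $N$ is a Poisson random measure on $(0,\infty)\times(0,\infty)$ with intensity $v(\mathrm{d}z)\,\mathrm{d}t$, associated with a (spectrally positive) pure-jump subordinator whose Lévy measure is $v$ (possibly with $v((0,\infty))=+\infty$); $\tilde{N}(\mathrm{d}z,\mathrm{d}s)=N(\mathrm{d}z,\mathrm{d}s)-v(\mathrm{d}z)\,\mathrm{d}s$. The solution of the stochastic differential equation on $[0,1)$ is the càdlàg adapted process given by $X_t^*=\mathbb{E}[X_t^*]+Y_t$, where $$Y_t=\int_0^t\exp\left(-\int_s^t(r+A_\tau)\,\mathrm{d}\tau\right)\int_0^{+\infty}z\,\tilde{N}(\mathrm{d}z,\mathrm{d}s)$$ and $$\mathbb{E}[X_t^*]=x_0\exp\left(-\int_0^t(r+A_s)\,\mathrm{d}s\right)+\int_0^t\exp\left(-\int_s^t(r+A_\tau)\,\mathrm{d}\tau\right)(-B_s+M_1)\,\mathrm{d}s .$$ *)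

theory Defs
  imports "HOL-Probability.Probability"
begin

text \<open>The random measure is a family \<open>N \<omega>\<close> of measures with the \<sigma>-algebra of the intensity
  \<open>\<mu>\<close>. The Poisson law is written out instead of using \<^const>\<open>poisson_pmf\<close>, whose rate must be
  positive: rate 0 has to be allowed here.\<close>

definition poisson_random_measure ::
    "'w measure \<Rightarrow> 'e measure \<Rightarrow> ('w \<Rightarrow> 'e measure) \<Rightarrow> bool" where
  "poisson_random_measure M \<mu> N \<longleftrightarrow>
     (\<forall>\<omega>\<in>space M. sets (N \<omega>) = sets \<mu>) \<and>
     (\<forall>E\<in>sets \<mu>. (\<lambda>\<omega>. emeasure (N \<omega>) E) \<in> borel_measurable M) \<and>
     (\<forall>E\<in>sets \<mu>. emeasure \<mu> E < \<infinity> \<longrightarrow>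
        (\<forall>k::nat. measure M {\<omega>\<in>space M. emeasure (N \<omega>) E = of_nat k} =
           exp (- measure \<mu> E) * measure \<mu> E ^ k / fact k)) \<and>
     (\<forall>E\<in>sets \<mu>. emeasure \<mu> E = \<infinity> \<longrightarrow> (AE \<omega> in M. emeasure (N \<omega>) E = \<infinity>)) \<and>
     (\<forall>(E :: nat \<Rightarrow> 'e set) I. finite I \<and> E ` I \<subseteq> sets \<mu> \<and> disjoint_family_on E I \<longrightarrow>
        prob_space.indep_vars M (\<lambda>_. borel) (\<lambda>i \<omega>. emeasure (N \<omega>) (E i)) I)"

text \<open>Marks are in the first component and time in the second. The filtration is indexed by all
  of \<^typ>\<open>real\<close>; a filtration on \<open>[0, \<infinity>)\<close> is extended by \<open>F t = F 0\<close> for negative \<open>t\<close>.\<close>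

definition filtered_poisson_random_measure ::
    "'w measure \<Rightarrow> (real \<Rightarrow> 'w measure) \<Rightarrow> (real \<times> real) measure \<Rightarrow>
     ('w \<Rightarrow> (real \<times> real) measure) \<Rightarrow> bool" where
  "filtered_poisson_random_measure M F \<mu> N \<longleftrightarrow>
     poisson_random_measure M \<mu> N \<and>
     filtration (space M) F \<and> (\<forall>t. subalgebra M (F t)) \<and>
     (\<forall>t\<ge>0. \<forall>E\<in>sets \<mu>. E \<subseteq> UNIV \<times> {..t} \<longrightarrow>
        (\<lambda>\<omega>. emeasure (N \<omega>) E) \<in> borel_measurable (F t)) \<and>
     (\<forall>t\<ge>0. prob_space.indep_set M (sets (F t))
        (sigma_sets (space M) {(\<lambda>\<omega>. emeasure (N \<omega>) E) -` U \<inter> space M | E U.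
           E \<in> sets \<mu> \<and> E \<subseteq> UNIV \<times> {t<..} \<and> U \<in> sets borel}))"

definition jump_time_intensity :: "real measure \<Rightarrow> (real \<times> real) measure" where
  "jump_time_intensity v = v \<Otimes>\<^sub>M restrict_space lborel {0<..}"

definition jump_moment :: "real measure \<Rightarrow> nat \<Rightarrow> real" where
  "jump_moment v k = (\<integral>z. z ^ k \<partial>v)"

text \<open>The integral of \<open>h\<close> over \<open>S\<close> with respect to \<open>n - \<mu>\<close>, for a realisation \<open>n\<close> of the random
  measure and \<open>h\<close> integrable over \<open>S\<close> with respect to \<open>\<mu>\<close> (so, almost surely, also with respect
  to \<open>n\<close>).\<close>

definition compensated_integral ::
    "'e measure \<Rightarrow> 'e measure \<Rightarrow> 'e set \<Rightarrow> ('e \<Rightarrow> real) \<Rightarrow> real" where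
  "compensated_integral \<mu> n S h = (\<integral>p\<in>S. h p \<partial>n) - (\<integral>p\<in>S. h p \<partial>\<mu>)"

definition cadlag_on_Ico :: "real \<Rightarrow> real \<Rightarrow> (real \<Rightarrow> real) \<Rightarrow> bool" where
  "cadlag_on_Ico a b f \<longleftrightarrow>
     (\<forall>t\<in>{a..<b}. (f \<longlongrightarrow> f t) (at_right t)) \<and>
     (\<forall>t\<in>{a<..<b}. \<exists>l. (f \<longlongrightarrow> l) (at_left t))"

text \<open>A cadlag adapted solution on \<open>[0, T)\<close>, in integral form, of
  \<open>dX\<^sub>t = \<beta>(t, X\<^sub>t) dt + \<integral>\<^sub>0\<^sup>\<infinity> z (N - \<mu>)(dz, dt)\<close> with \<open>X\<^sub>0 = x0\<close>.\<close>

definition jump_sde_solution ::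
    "'w measure \<Rightarrow> (real \<Rightarrow> 'w measure) \<Rightarrow> (real \<times> real) measure \<Rightarrow>
     ('w \<Rightarrow> (real \<times> real) measure) \<Rightarrow> real \<Rightarrow> (real \<Rightarrow> real \<Rightarrow> real) \<Rightarrow> real \<Rightarrow>
     (real \<Rightarrow> 'w \<Rightarrow> real) \<Rightarrow> bool" where
  "jump_sde_solution M F \<mu> N T \<beta> x0 X \<longleftrightarrow>
     (\<forall>t\<in>{0..<T}. X t \<in> borel_measurable (F t)) \<and>
     (AE \<omega> in M. cadlag_on_Ico 0 T (\<lambda>t. X t \<omega>)) \<and>
     (AE \<omega> in M. X 0 \<omega> = x0) \<and>
     (AE \<omega> in M. \<forall>t\<in>{0..<T}.
        set_integrable lborel {0..t} (\<lambda>s. \<beta> s (X s \<omega>)) \<and>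
        X t \<omega> = x0 + (\<integral>s\<in>{0..t}. \<beta> s (X s \<omega>) \<partial>lborel)
          + compensated_integral \<mu> (N \<omega>) ({0<..} \<times> {0<..t}) (\<lambda>(z, s). z))"

definition coeff_A :: "real \<Rightarrow> real \<Rightarrow> real" where
  "coeff_A r t = 2 * r / (exp (2 * r * (1 - t)) - 1)"

definition coeff_B :: "real \<Rightarrow> real \<Rightarrow> real \<Rightarrow> real \<Rightarrow> real" where
  "coeff_B r m xhat t =
     2 * r * (- xhat + m / r * (1 - exp (- r * (1 - t)))) /
     (exp (r * (1 - t)) * (1 - exp (- 2 * r * (1 - t))))"

end

theory Submission
  imports Defs "HOL-Real_Asymp.Real_Asymp"
begin

text \<open>The convergence holds path by path; probability enters only through the fact that the noise \<open>L\<close>,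
  the compensated sum of jumps, almost surely has a left limit \<open>l\<close> at the terminal time \<open>1\<close>. That fact
  is Campbell's formula: the expected sum of the jumps up to time \<open>1\<close> is the first moment of \<open>v\<close>, which
  is finite, so almost every path has summable jumps
  (\<open>poisson_random_measure_campbell\<close>, \<open>compensated_jumps_left_limit\<close>).

  For a fixed path \<open>f\<close>, put \<open>g = f - L\<close> and \<open>a t = r + coeff_A r t\<close>. The integral equation says that \<open>g\<close> is an
  ordinary integral, and its right derivative is \<open>a (c - g)\<close> where \<open>c = (m - coeff_B) / a - L\<close>. So \<open>g\<close> is
  pulled at rate \<open>a\<close> towards \<open>c\<close>. The pull is infinitely strong in total:
  \<open>a t = r coth (r (1 - t))\<close> has the integrating factor \<open>1 / sinh (r (1 - t))\<close>, which explodes at time \<open>1\<close>.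
  Hence \<open>g\<close> has the same limit as \<open>c\<close> (\<open>relaxation_tendsto\<close>), and since \<open>(m - coeff_B) / a\<close> tends to \<open>xhat\<close>,
  this limit is \<open>xhat - l\<close>. Adding \<open>L\<close> back gives \<open>f \<longlongrightarrow> xhat\<close>, whatever \<open>l\<close> is (\<open>bridge_path_tendsto\<close>).

  Working with \<open>g\<close> avoids both the explicit solution formula and stochastic integrals against the
  jump path: the singular coefficients meet only an ordinary integral, and cadlag paths make its
  integrand right-continuous, so that one-sided calculus is enough.\<close>

section \<open>Functions with right derivatives\<close>

text \<open>Only one-sided derivatives are available below, because a cadlag path may jump. Tilting \<open>w\<close> by
  a small slope \<open>e\<close> makes every right derivative strictly negative, so that the last point at which
  the tilted function is at most \<open>0\<close> cannot lie before \<open>b\<close>.\<close>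

lemma nonincreasing_if_right_derivative_nonpos:
  fixes w d :: "real \<Rightarrow> real"
  assumes "a \<le> b" and cont: "continuous_on {a..b} w"
    and deriv: "\<And>x. x \<in> {a..<b} \<Longrightarrow> (w has_real_derivative d x) (at_right x)"
    and nonpos: "\<And>x. x \<in> {a..<b} \<Longrightarrow> d x \<le> 0"
  shows "w b \<le> w a"
proof (rule ccontr)
  assume "\<not> w b \<le> w a"
  then have less: "w a < w b" by simp
  with \<open>a \<le> b\<close> have "a < b" by (cases "a = b") auto
  define e where "e = (w b - w a) / (2 * (b - a))"
  have "e > 0" using less \<open>a < b\<close> by (simp add: e_def)
  define u where "u x = w x - w a - e * (x - a)" for x
  have "e * (b - a) = (w b - w a) / 2" using \<open>a < b\<close> by (simp add: e_def divide_simps)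
  then have ub: "u b > 0" using less by (simp add: u_def)
  have contu: "continuous_on {a..b} u" unfolding u_def by (intro continuous_intros cont)
  define S where "S = {x \<in> {a..b}. u x \<le> 0}"
  have "closed S" unfolding S_def
    using continuous_on_closed_Collect_le[OF contu continuous_on_const closed_atLeastAtMost]
    by simp
  then have "compact S"
    using closed_Int_compact[OF _ compact_Icc[of a b], of S] by (simp add: S_def Int_def conj_ac)
  moreover have "a \<in> S" using \<open>a < b\<close> by (simp add: S_def u_def)
  ultimately obtain s where s: "s \<in> S" and max: "\<And>x. x \<in> S \<Longrightarrow> x \<le> s"
    using compact_attains_sup[of S] by blast
  have "s \<noteq> b" using s ub by (auto simp: S_def)
  then have sab: "s \<in> {a..<b}" using s by (auto simp: S_def)
  have "(u has_real_derivative (d s - e)) (at_right s)"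
    unfolding u_def by (auto intro!: derivative_eq_intros deriv[OF sab])
  moreover have "d s - e < 0" using nonpos[OF sab] \<open>e > 0\<close> by simp
  ultimately obtain \<delta> where "\<delta> > 0"
    and dec: "\<And>h. h > 0 \<Longrightarrow> s + h \<in> {s<..} \<Longrightarrow> h < \<delta> \<Longrightarrow> u (s + h) < u s"
    using has_real_derivative_neg_dec_right by metis
  define h where "h = min (\<delta> / 2) (b - s)"
  have "h > 0" "h < \<delta>" "s + h \<le> b" using \<open>\<delta> > 0\<close> sab by (auto simp: h_def)
  then have "u (s + h) < u s" using dec by simp
  then have "s + h \<in> S" using s \<open>h > 0\<close> \<open>s + h \<le> b\<close> by (auto simp: S_def)
  with max[OF this] \<open>h > 0\<close> show False by simp
qed

text \<open>One-sided fundamental theorem of calculus: the right derivative of a primitive sees only the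
  integrand to the right of the point, so a jump of the integrand is a mere corner of the primitive.\<close>

lemma right_continuous_integral_right_derivative:
  fixes h :: "real \<Rightarrow> real"
  assumes int: "\<And>t. t \<in> {S..<T} \<Longrightarrow> h integrable_on {S..t}"
    and right: "\<And>t. t \<in> {S..<T} \<Longrightarrow> (h \<longlongrightarrow> h t) (at_right t)"
  shows "continuous_on {S..<T} (\<lambda>t. integral {S..t} h)"
    and "t \<in> {S..<T} \<Longrightarrow> ((\<lambda>t. integral {S..t} h) has_real_derivative h t) (at_right t)"
proof -
  show "continuous_on {S..<T} (\<lambda>t. integral {S..t} h)"
    unfolding continuous_on_eq_continuous_within
  proof
    fix x assume x: "x \<in> {S..<T}"
    define b where "b = (x + T) / 2"
    have b: "x < b" "b \<in> {S..<T}" using x by (auto simp: b_def)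
    have "continuous (at x within {S..b}) (\<lambda>t. integral {S..t} h)"
      using indefinite_integral_continuous_1[OF int[OF b(2)]] x b
      by (auto simp: continuous_on_eq_continuous_within)
    moreover have "at x within {S..b} = at x within {S..<T}"
      by (rule at_within_nhd[of x "{..<b}"]) (use x b in auto)
    ultimately show "continuous (at x within {S..<T}) (\<lambda>t. integral {S..t} h)"
      by simp
  qed
next
  assume t: "t \<in> {S..<T}"
  define b where "b = (t + T) / 2"
  have b: "t < b" "b \<in> {S..<T}" using t by (auto simp: b_def)
  have int_b: "h integrable_on {S..b}" by (rule int[OF b(2)])
  then have "h integrable_on {t..b}"
    by (rule integrable_on_subinterval) (use t in auto)
  moreover have "continuous (at t within {t..b}) h"
    using right[OF t] b by (simp add: continuous_within at_within_Icc_at_right)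
  ultimately have "((\<lambda>u. integral {t..u} h) has_vector_derivative h t) (at t within {t..b})"
    using integral_has_vector_derivative_continuous_at[of h t b t "{}"] b by simp
  then have "((\<lambda>u. integral {S..t} h + integral {t..u} h) has_vector_derivative h t) (at t within {t..b})"
    by (auto intro!: derivative_eq_intros)
  then have "((\<lambda>u. integral {S..u} h) has_vector_derivative h t) (at t within {t..b})"
  proof (rule has_vector_derivative_transform_within[OF _ zero_less_one])
    fix u assume "u \<in> {t..b}"
    then show "integral {S..t} h + integral {t..u} h = integral {S..u} h"
      using t by (intro Henstock_Kurzweil_Integration.integral_combine integrable_on_subinterval[OF int_b]) auto
  qed (use b in auto)
  then show "((\<lambda>t. integral {S..t} h) has_real_derivative h t) (at_right t)"
    using b by (simp add: at_within_Icc_at_right has_real_derivative_iff_has_vector_derivative)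
qed

section \<open>Relaxation towards a moving target\<close>

text \<open>The equation \<open>g' = a (c - g)\<close> pulls \<open>g\<close> towards the moving target \<open>c\<close> at rate \<open>a\<close>. The integrating
  factor \<open>\<psi> = exp (\<integral> a)\<close> gives \<open>(\<psi> (g - K))' = a \<psi> (c - K)\<close>, which is nonpositive as soon as the target
  is below \<open>K\<close>. From then on \<open>\<psi> (g - K)\<close> is bounded above, and since \<open>\<psi>\<close> tends to infinity, any
  remaining excess of \<open>g\<close> over \<open>K\<close> is washed out.\<close>

lemma relaxation_eventually_less:
  fixes a c g \<psi> :: "real \<Rightarrow> real"
  assumes "S < T" and cont: "continuous_on {S..<T} g"
    and deriv: "\<And>t. t \<in> {S..<T} \<Longrightarrow> (g has_real_derivative a t * (c t - g t)) (at_right t)"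
    and rate: "\<And>t. t \<in> {S..<T} \<Longrightarrow> a t \<ge> 0"
    and pos: "\<And>t. t \<in> {S..<T} \<Longrightarrow> \<psi> t > 0"
    and \<psi>_deriv: "\<And>t. t \<in> {S..<T} \<Longrightarrow> (\<psi> has_real_derivative a t * \<psi> t) (at t)"
    and blowup: "filterlim \<psi> at_top (at_left T)"
    and target: "(c \<longlongrightarrow> l) (at_left T)" and "l < K'"
  shows "\<forall>\<^sub>F t in at_left T. g t < K'"
proof -
  \<comment> \<open>Two gaps are needed: the target eventually stays below \<open>K\<close>, and the remainder \<open>w t0 / \<psi> t\<close> has to fit
    between \<open>K\<close> and \<open>K'\<close>.\<close>
  define K where "K = (l + K') / 2"
  have K: "l < K" "K < K'" using \<open>l < K'\<close> by (auto simp: K_def)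
  obtain b where b: "b < T" "\<And>t. b < t \<Longrightarrow> t < T \<Longrightarrow> c t < K"
    using order_tendstoD(2)[OF target K(1)] \<open>S < T\<close> unfolding eventually_at_left[OF \<open>S < T\<close>] by blast
  define t0 where "t0 = max S ((b + T) / 2)"
  have t0: "S \<le> t0" "b < t0" "t0 < T" using b(1) \<open>S < T\<close> by (auto simp: t0_def less_max_iff_disj)
  define w where "w t = \<psi> t * (g t - K)" for t
  have w_le: "w t \<le> w t0" if t: "t0 \<le> t" "t < T" for t
  proof (rule nonincreasing_if_right_derivative_nonpos[OF t(1)])
    have "continuous_on {t0..t} \<psi>"
    proof (rule continuous_at_imp_continuous_on, rule ballI)
      fix x assume "x \<in> {t0..t}"
      then show "isCont \<psi> x" using t t0 by (intro DERIV_isCont[OF \<psi>_deriv]) auto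
    qed
    moreover have "continuous_on {t0..t} g"
      by (rule continuous_on_subset[OF cont]) (use t t0 in auto)
    ultimately show "continuous_on {t0..t} w" unfolding w_def by (intro continuous_intros)
  next
    fix x assume x: "x \<in> {t0..<t}"
    then have xST: "x \<in> {S..<T}" using t t0 by auto
    have "(w has_real_derivative a x * \<psi> x * (g x - K) + (a x * (c x - g x)) * \<psi> x) (at_right x)"
      unfolding w_def
      by (auto intro!: derivative_eq_intros deriv[OF xST]
          has_field_derivative_at_within[OF \<psi>_deriv[OF xST]])
    then show "(w has_real_derivative a x * \<psi> x * (c x - K)) (at_right x)"
      by (simp add: algebra_simps)
    have "c x < K" using b(2)[of x] x t t0 by auto
    then show "a x * \<psi> x * (c x - K) \<le> 0"
      using rate[OF xST] pos[OF xST] by (intro mult_nonneg_nonpos) auto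
  qed
  have "\<forall>\<^sub>F t in at_left T. t0 < t \<and> t < T"
    using t0(3) eventually_at_left by blast
  moreover have "\<forall>\<^sub>F t in at_left T. \<psi> t > \<bar>w t0\<bar> / (K' - K)"
    using blowup unfolding filterlim_at_top_dense by blast
  ultimately show ?thesis
  proof eventually_elim
    case (elim t)
    then have "\<psi> t > 0" using pos[of t] t0 by auto
    have "\<psi> t * (g t - K) \<le> w t0" using w_le[of t] elim by (simp add: w_def)
    also have "\<dots> < \<psi> t * (K' - K)"
      using elim K by (simp add: field_simps)
    finally show "g t < K'" using \<open>\<psi> t > 0\<close> by simp
  qed
qed

text \<open>The equation is invariant under changing the signs of \<open>g\<close> and \<open>c\<close>, so the upper bound also
  yields the lower one.\<close>

lemma relaxation_tendsto:
  fixes a c g \<psi> :: "real \<Rightarrow> real"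
  assumes "S < T" and cont: "continuous_on {S..<T} g"
    and deriv: "\<And>t. t \<in> {S..<T} \<Longrightarrow> (g has_real_derivative a t * (c t - g t)) (at_right t)"
    and rate: "\<And>t. t \<in> {S..<T} \<Longrightarrow> a t \<ge> 0"
    and pos: "\<And>t. t \<in> {S..<T} \<Longrightarrow> \<psi> t > 0"
    and \<psi>_deriv: "\<And>t. t \<in> {S..<T} \<Longrightarrow> (\<psi> has_real_derivative a t * \<psi> t) (at t)"
    and blowup: "filterlim \<psi> at_top (at_left T)"
    and target: "(c \<longlongrightarrow> l) (at_left T)"
  shows "(g \<longlongrightarrow> l) (at_left T)"
proof (rule order_tendstoI)
  fix K assume "l < K"
  with assms show "\<forall>\<^sub>F t in at_left T. g t < K" by (intro relaxation_eventually_less)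
next
  fix K assume "K < l"
  have "\<forall>\<^sub>F t in at_left T. - g t < - K"
  proof (rule relaxation_eventually_less[where S = S and a = a and c = "\<lambda>t. - c t" and \<psi> = \<psi> and l = "- l"])
    show "continuous_on {S..<T} (\<lambda>t. - g t)" by (intro continuous_intros cont)
    show "((\<lambda>t. - g t) has_real_derivative a t * (- c t - - g t)) (at_right t)" if "t \<in> {S..<T}" for t
      using DERIV_minus[OF deriv[OF that]] by (simp add: algebra_simps)
    show "((\<lambda>t. - c t) \<longlongrightarrow> - l) (at_left T)" by (intro tendsto_minus target)
  qed (use assms \<open>K < l\<close> in auto)
  then show "\<forall>\<^sub>F t in at_left T. K < g t" by eventually_elim simp
qed

section \<open>Paths of the bridge equation\<close>

text \<open>As a function of \<open>x\<close>, the drift \<open>- (r + coeff_A r t) x - coeff_B r m' xhat t + m\<close> vanishes exactly at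
  the quotient below, which is therefore the level towards which it pulls at time \<open>t\<close>. Near the terminal time the singular
  parts of \<^const>\<open>coeff_A\<close> and \<^const>\<open>coeff_B\<close> are \<open>1 / (1 - t)\<close> and \<open>- xhat / (1 - t)\<close>, and only they
  count.\<close>

lemma drift_equilibrium_tendsto:
  fixes r m xhat :: real
  assumes "r > 0"
  shows "((\<lambda>t. (m - coeff_B r m' xhat t) / (r + coeff_A r t)) \<longlongrightarrow> xhat) (at_left 1)"
  unfolding coeff_A_def coeff_B_def using assms by real_asymp

text \<open>The rate of mean reversion is \<open>r coth (r (1 - t))\<close>, minus the logarithmic derivative of
  \<open>sinh (r (1 - t))\<close>. This identifies \<open>1 / sinh (r (1 - t))\<close> as an integrating factor; its divergence
  at the terminal time says that the accumulated mean reversion is infinite.\<close>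

lemma mean_reversion_rate_coth:
  assumes "r > 0" "t < 1"
  shows "r + coeff_A r t = r * cosh (r * (1 - t)) / sinh (r * (1 - t))"
proof -
  define y where "y = r * (1 - t)"
  have "y > 0" using assms by (simp add: y_def)
  have double: "exp (2 * y) = exp y * exp y" by (simp flip: exp_add)
  have "exp y * exp y > 1" using \<open>y > 0\<close> unfolding double[symmetric] by simp
  then have "r + 2 * r / (exp (2 * y) - 1) = r * cosh y / sinh y"
    unfolding double by (simp add: cosh_def sinh_def exp_minus field_simps)
  then show ?thesis by (simp add: y_def coeff_A_def mult.assoc)
qed

lemma inverse_sinh_integrating_factor:
  assumes "r > 0" "t < 1"
  shows "((\<lambda>t. 1 / sinh (r * (1 - t))) has_real_derivative (r + coeff_A r t) * (1 / sinh (r * (1 - t)))) (at t)"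
proof -
  have "sinh (r * (1 - t)) > 0" using assms by simp
  then show ?thesis unfolding mean_reversion_rate_coth[OF assms]
    by (auto intro!: derivative_eq_intros simp: field_simps)
qed

lemma inverse_sinh_at_top:
  fixes r :: real
  assumes "r > 0"
  shows "filterlim (\<lambda>t. 1 / sinh (r * (1 - t))) at_top (at_left 1)"
  using assms by real_asymp

text \<open>The pathwise core. Subtracting the noise leaves \<open>g = f - L\<close>, which has right derivatives
  everywhere and satisfies \<open>g' = a (c - g)\<close> with the shifted target \<open>c = (m - coeff_B) / a - L\<close>. Thus \<open>g\<close>
  tends to \<open>xhat - l\<close>, and adding \<open>L\<close> back cancels the unknown limit \<open>l\<close>: it does not matter what the
  noise does, as long as it settles down.\<close>

lemma bridge_path_tendsto:
  fixes f L :: "real \<Rightarrow> real"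
  assumes "r > 0"
    and right: "\<And>t. t \<in> {0..<1} \<Longrightarrow> (f \<longlongrightarrow> f t) (at_right t)"
    and int: "\<And>t. t \<in> {0..<1} \<Longrightarrow>
      set_integrable lborel {0..t} (\<lambda>s. - (r + coeff_A r s) * f s - coeff_B r m xhat s + m)"
    and eq: "\<And>t. t \<in> {0..<1} \<Longrightarrow>
      f t = x0 + (\<integral>s\<in>{0..t}. (- (r + coeff_A r s) * f s - coeff_B r m xhat s + m) \<partial>lborel) + L t"
    and L: "(L \<longlongrightarrow> l) (at_left 1)"
  shows "(f \<longlongrightarrow> xhat) (at_left 1)"
proof -
  define a where "a s = r + coeff_A r s" for s
  define h where "h s = - a s * f s - coeff_B r m xhat s + m" for s
  define g where "g t = x0 + integral {0..t} h" for t
  define c where "c t = (m - coeff_B r m xhat t) / a t - L t" for t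
  have int_h: "h integrable_on {0..t}" and f_eq: "f t = g t + L t" if t: "t \<in> {0..<1}" for t
    using set_borel_integral_eq_integral[OF int[OF t]] eq[OF t]
    by (simp_all add: h_def[abs_def] g_def a_def)
  have a_pos: "a t > 0" if "t \<in> {0..<1}" for t
    using that \<open>r > 0\<close> by (simp add: a_def mean_reversion_rate_coth cosh_real_pos)
  have "isCont (coeff_A r) t" "isCont (coeff_B r m xhat) t" if "t \<in> {0..<1}" for t
    unfolding coeff_A_def[abs_def] coeff_B_def[abs_def]
    using that \<open>r > 0\<close> by (auto intro!: continuous_intros)
  then have coeffs: "(coeff_A r \<longlongrightarrow> coeff_A r t) (at_right t)"
    "(coeff_B r m xhat \<longlongrightarrow> coeff_B r m xhat t) (at_right t)" if "t \<in> {0..<1}" for t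
    using that by (auto simp: isCont_def intro: filterlim_at_within_not_equal tendsto_within_subset)
  have right_h: "(h \<longlongrightarrow> h t) (at_right t)" if "t \<in> {0..<1}" for t
    unfolding h_def a_def by (intro tendsto_intros coeffs right that)
  note g = right_continuous_integral_right_derivative[OF int_h right_h]
  have "(g \<longlongrightarrow> xhat - l) (at_left 1)"
  proof (rule relaxation_tendsto[where S = 0 and a = a and c = c and \<psi> = "\<lambda>t. 1 / sinh (r * (1 - t))"])
    show "continuous_on {0..<1} g" unfolding g_def by (intro continuous_intros g(1))
    show "(g has_real_derivative a t * (c t - g t)) (at_right t)" if t: "t \<in> {0..<1}" for t
    proof -
      have "h t = a t * (c t - g t)"
        using f_eq[OF t] a_pos[OF t] by (simp add: h_def c_def field_simps)
      moreover have "(g has_real_derivative 0 + h t) (at_right t)"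
        unfolding g_def by (rule DERIV_add[OF DERIV_const g(2)[OF _ _ t]])
      ultimately show ?thesis by simp
    qed
    show "(c \<longlongrightarrow> xhat - l) (at_left 1)"
      unfolding c_def a_def by (intro tendsto_diff drift_equilibrium_tendsto L \<open>r > 0\<close>)
    show "((\<lambda>t. 1 / sinh (r * (1 - t))) has_real_derivative a t * (1 / sinh (r * (1 - t)))) (at t)"
      if "t \<in> {0..<1}" for t
      using inverse_sinh_integrating_factor[of r t] that \<open>r > 0\<close> by (simp add: a_def)
  qed (use a_pos \<open>r > 0\<close> inverse_sinh_at_top in \<open>auto intro: less_imp_le\<close>)
  then have "((\<lambda>t. g t + L t) \<longlongrightarrow> xhat - l + l) (at_left 1)" by (intro tendsto_add L)
  moreover have "\<forall>\<^sub>F t in at_left 1. g t + L t = f t"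
  proof -
    have "\<forall>\<^sub>F t::real in at_left 1. t \<in> {0<..<1}" by (rule eventually_at_left_real) simp
    then show ?thesis by eventually_elim (simp add: f_eq)
  qed
  ultimately show ?thesis by (simp add: tendsto_cong)
qed

section \<open>Integrals against a Poisson random measure\<close>

text \<open>The mean of a Poisson law, computed from the point probabilities: since these add up to \<open>1\<close>, \<open>Y\<close>
  is almost surely finite, and the shift \<open>(k + 1) p (k + 1) = m p k\<close> turns the series for the mean into
  \<open>m\<close> times the total mass.\<close>

lemma (in prob_space) nn_integral_poisson_law:
  fixes Y :: "'a \<Rightarrow> ennreal"
  assumes [measurable]: "Y \<in> borel_measurable M" and "m \<ge> 0"
    and poisson: "\<And>k::nat. measure M {\<omega>\<in>space M. Y \<omega> = of_nat k} = exp (- m) * m ^ k / fact k"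
  shows "(\<integral>\<^sup>+ \<omega>. Y \<omega> \<partial>M) = ennreal m"
proof -
  define B where "B k = {\<omega>\<in>space M. Y \<omega> = of_nat k}" for k :: nat
  have B [measurable]: "B k \<in> sets M" for k unfolding B_def by measurable
  have disj: "disjoint_family B" by (auto simp: disjoint_family_on_def B_def)
  have "(\<lambda>k. exp (- m) * (m ^ k / fact k)) sums (exp (- m) * exp m)"
    using exp_converges[of m] by (intro sums_mult) (simp add: divide_inverse ac_simps)
  then have total: "(\<lambda>k. prob (B k)) sums 1"
    using poisson by (simp add: B_def flip: exp_add)
  have "(\<lambda>k. prob (B k)) sums prob (\<Union>k. B k)"
    using B disj by (intro finite_measure_UNION) auto
  with total have "prob (\<Union>k. B k) = 1" by (rule sums_unique2[symmetric])
  then have nat_valued: "AE \<omega> in M. \<omega> \<in> (\<Union>k. B k)" by (rule AE_prob_1)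
  have "(\<integral>\<^sup>+ \<omega>. Y \<omega> \<partial>M) = (\<integral>\<^sup>+ \<omega>. (\<Sum>k. of_nat k * indicator (B k) \<omega>) \<partial>M)"
  proof (rule nn_integral_cong_AE, use nat_valued in eventually_elim)
    case (elim \<omega>)
    then obtain j where j: "\<omega> \<in> B j" by auto
    then have "of_nat k * indicator (B k) \<omega> = (if k = j then Y \<omega> else 0)" for k
      using disj by (auto simp: B_def indicator_def)
    then show ?case using sums_unique[OF sums_single[of j "\<lambda>_. Y \<omega>"]] by simp
  qed
  also have "\<dots> = (\<Sum>k. of_nat k * emeasure M (B k))"
    by (subst nn_integral_suminf) (simp_all add: nn_integral_cmult_indicator)
  also have "\<dots> = (\<Sum>k. ennreal (real k * prob (B k)))"
    by (simp add: emeasure_eq_measure ennreal_mult'' ennreal_of_nat_eq_real_of_nat)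
  also have "(\<lambda>k. real k * prob (B k)) sums m"
  proof -
    have "real (Suc k) * prob (B (Suc k)) = m * prob (B k)" for k
      unfolding B_def poisson fact_Suc by (simp add: divide_simps del: of_nat_Suc)
    then have "(\<lambda>k. real (Suc k) * prob (B (Suc k))) sums m"
      using sums_mult[OF total, of m] by simp
    from sums_Suc[OF this] show ?thesis by simp
  qed
  then have "(\<Sum>k. ennreal (real k * prob (B k))) = ennreal m"
    by (subst suminf_ennreal2) (auto simp: sums_iff)
  finally show ?thesis .
qed

lemma poisson_random_measure_intensity:
  assumes "prob_space M" and N: "poisson_random_measure M \<mu> N" and E: "E \<in> sets \<mu>"
  shows "(\<integral>\<^sup>+ \<omega>. emeasure (N \<omega>) E \<partial>M) = emeasure \<mu> E"
proof -
  interpret prob_space M by fact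
  show ?thesis
  proof (cases "emeasure \<mu> E = \<infinity>")
    case True
    then have "AE \<omega> in M. emeasure (N \<omega>) E = \<infinity>"
      using N E by (auto simp: poisson_random_measure_def)
    then have "(\<integral>\<^sup>+ \<omega>. emeasure (N \<omega>) E \<partial>M) = (\<integral>\<^sup>+ \<omega>. \<infinity> \<partial>M)"
      by (rule nn_integral_cong_AE)
    with True show ?thesis by (simp add: emeasure_space_1)
  next
    case False
    have "(\<integral>\<^sup>+ \<omega>. emeasure (N \<omega>) E \<partial>M) = ennreal (measure \<mu> E)"
      using N E False by (intro nn_integral_poisson_law) (auto simp: poisson_random_measure_def less_top)
    then show ?thesis using False by (simp add: emeasure_eq_ennreal_measure)
  qed
qed

text \<open>Campbell's formula. The intensity identity is the case of indicator functions, and both sides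
  are compatible with the operations from which nonnegative measurable functions are built.
  Measurability of the inner integral in \<open>\<omega>\<close> belongs to the induction, because additivity and monotone
  convergence of the outer integral depend on it.\<close>

lemma poisson_random_measure_campbell:
  fixes u :: "'e \<Rightarrow> ennreal"
  assumes "prob_space M" and N: "poisson_random_measure M \<mu> N" and u: "u \<in> borel_measurable \<mu>"
  shows "(\<lambda>\<omega>. \<integral>\<^sup>+ p. u p \<partial>N \<omega>) \<in> borel_measurable M \<and>
         (\<integral>\<^sup>+ \<omega>. \<integral>\<^sup>+ p. u p \<partial>N \<omega> \<partial>M) = (\<integral>\<^sup>+ p. u p \<partial>\<mu>)"
proof -
  have setsN: "\<And>\<omega>. \<omega> \<in> space M \<Longrightarrow> sets (N \<omega>) = sets \<mu>"
    and meas: "\<And>E. E \<in> sets \<mu> \<Longrightarrow> (\<lambda>\<omega>. emeasure (N \<omega>) E) \<in> borel_measurable M"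
    using N by (auto simp: poisson_random_measure_def)
  have measN: "f \<in> borel_measurable (N \<omega>)" if "\<omega> \<in> space M" "f \<in> borel_measurable \<mu>"
    for \<omega> and f :: "'e \<Rightarrow> ennreal"
    using that measurable_cong_sets[OF setsN[OF that(1)] refl] by auto
  let ?P = "\<lambda>u. (\<lambda>\<omega>. \<integral>\<^sup>+ p. u p \<partial>N \<omega>) \<in> borel_measurable M \<and>
    (\<integral>\<^sup>+ \<omega>. \<integral>\<^sup>+ p. u p \<partial>N \<omega> \<partial>M) = (\<integral>\<^sup>+ p. u p \<partial>\<mu>)"
  \<comment> \<open>The integrals against \<open>N \<omega>\<close> may be rewritten for \<open>\<omega> \<in> space M\<close> only: elsewhere \<open>N \<omega>\<close> is arbitrary.\<close>
  have by_eq: "?P f" if "w \<in> borel_measurable M"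
    and eq: "\<And>\<omega>. \<omega> \<in> space M \<Longrightarrow> (\<integral>\<^sup>+ p. f p \<partial>N \<omega>) = w \<omega>"
    and "(\<integral>\<^sup>+ \<omega>. w \<omega> \<partial>M) = (\<integral>\<^sup>+ p. f p \<partial>\<mu>)" for w and f :: "'e \<Rightarrow> ennreal"
  proof
    show "(\<lambda>\<omega>. \<integral>\<^sup>+ p. f p \<partial>N \<omega>) \<in> borel_measurable M"
      by (subst measurable_cong[where g = w]) (rule eq, assumption, rule that(1))
    have "(\<integral>\<^sup>+ \<omega>. \<integral>\<^sup>+ p. f p \<partial>N \<omega> \<partial>M) = (\<integral>\<^sup>+ \<omega>. w \<omega> \<partial>M)"
      by (rule nn_integral_cong) (rule eq)
    with that(3) show "(\<integral>\<^sup>+ \<omega>. \<integral>\<^sup>+ p. f p \<partial>N \<omega> \<partial>M) = (\<integral>\<^sup>+ p. f p \<partial>\<mu>)"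
      by (rule trans[rotated])
  qed
  show "?P u"
    using u
  proof (induction rule: borel_measurable_induct)
    case (cong f g)
    show ?case
    proof (rule by_eq[where w = "\<lambda>\<omega>. \<integral>\<^sup>+ p. g p \<partial>N \<omega>"])
      show "(\<integral>\<^sup>+ p. f p \<partial>N \<omega>) = (\<integral>\<^sup>+ p. g p \<partial>N \<omega>)" if "\<omega> \<in> space M" for \<omega>
        by (rule nn_integral_cong, rule cong(3)) (simp add: sets_eq_imp_space_eq[OF setsN[OF that]])
      have "(\<integral>\<^sup>+ p. f p \<partial>\<mu>) = (\<integral>\<^sup>+ p. g p \<partial>\<mu>)"
        using cong(3) by (rule nn_integral_cong)
      then show "(\<integral>\<^sup>+ \<omega>. \<integral>\<^sup>+ p. g p \<partial>N \<omega> \<partial>M) = (\<integral>\<^sup>+ p. f p \<partial>\<mu>)" using cong(4) by simp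
    qed (use cong(4) in simp)
  next
    case (set A)
    show ?case
    proof (rule by_eq[where w = "\<lambda>\<omega>. emeasure (N \<omega>) A"])
      show "(\<integral>\<^sup>+ p. indicator A p \<partial>N \<omega>) = emeasure (N \<omega>) A" if "\<omega> \<in> space M" for \<omega>
        by (rule nn_integral_indicator) (simp add: setsN[OF that] set)
      show "(\<lambda>\<omega>. emeasure (N \<omega>) A) \<in> borel_measurable M" by (rule meas[OF set])
      show "(\<integral>\<^sup>+ \<omega>. emeasure (N \<omega>) A \<partial>M) = (\<integral>\<^sup>+ p. indicator A p \<partial>\<mu>)"
        by (simp only: poisson_random_measure_intensity[OF assms(1) N set] nn_integral_indicator[OF set])
    qed
  next
    case (mult f c)
    show ?case
    proof (rule by_eq[where w = "\<lambda>\<omega>. c * (\<integral>\<^sup>+ p. f p \<partial>N \<omega>)"])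
      show "(\<integral>\<^sup>+ p. c * f p \<partial>N \<omega>) = c * (\<integral>\<^sup>+ p. f p \<partial>N \<omega>)" if "\<omega> \<in> space M" for \<omega>
        by (rule nn_integral_cmult[OF measN[OF that mult(2)]])
      show "(\<lambda>\<omega>. c * (\<integral>\<^sup>+ p. f p \<partial>N \<omega>)) \<in> borel_measurable M"
        by (rule borel_measurable_times_ennreal[OF borel_measurable_const conjunct1[OF mult.IH]])
      show "(\<integral>\<^sup>+ \<omega>. c * (\<integral>\<^sup>+ p. f p \<partial>N \<omega>) \<partial>M) = (\<integral>\<^sup>+ p. c * f p \<partial>\<mu>)"
        by (simp only: nn_integral_cmult[OF conjunct1[OF mult.IH]] nn_integral_cmult[OF mult(2)]
            conjunct2[OF mult.IH])
    qed
  next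
    case (add f g)
    note f = add(1) conjunct1[OF add.IH(1)] conjunct2[OF add.IH(1)]
      and g = add(3) conjunct1[OF add.IH(2)] conjunct2[OF add.IH(2)]
    show ?case
    proof (rule by_eq[where w = "\<lambda>\<omega>. (\<integral>\<^sup>+ p. g p \<partial>N \<omega>) + (\<integral>\<^sup>+ p. f p \<partial>N \<omega>)"])
      show "(\<integral>\<^sup>+ p. g p + f p \<partial>N \<omega>) = (\<integral>\<^sup>+ p. g p \<partial>N \<omega>) + (\<integral>\<^sup>+ p. f p \<partial>N \<omega>)"
        if "\<omega> \<in> space M" for \<omega>
        by (rule nn_integral_add[OF measN[OF that g(1)] measN[OF that f(1)]])
      show "(\<lambda>\<omega>. (\<integral>\<^sup>+ p. g p \<partial>N \<omega>) + (\<integral>\<^sup>+ p. f p \<partial>N \<omega>)) \<in> borel_measurable M"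
        by (rule borel_measurable_add[OF g(2) f(2)])
      show "(\<integral>\<^sup>+ \<omega>. (\<integral>\<^sup>+ p. g p \<partial>N \<omega>) + (\<integral>\<^sup>+ p. f p \<partial>N \<omega>) \<partial>M) = (\<integral>\<^sup>+ p. g p + f p \<partial>\<mu>)"
        by (simp only: nn_integral_add[OF g(2) f(2)] nn_integral_add[OF g(1) f(1)] f(3) g(3))
    qed
  next
    case (seq U)
    note U = seq(1) conjunct1[OF seq.IH] conjunct2[OF seq.IH]
    show ?case
      unfolding SUP_apply
    proof (rule by_eq[where w = "\<lambda>\<omega>. SUP i. \<integral>\<^sup>+ p. U i p \<partial>N \<omega>"])
      show "(\<integral>\<^sup>+ p. (SUP i. U i p) \<partial>N \<omega>) = (SUP i. \<integral>\<^sup>+ p. U i p \<partial>N \<omega>)"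
        if "\<omega> \<in> space M" for \<omega>
        by (rule nn_integral_monotone_convergence_SUP[OF \<open>incseq U\<close> measN[OF that U(1)]])
      show "(\<lambda>\<omega>. SUP i. \<integral>\<^sup>+ p. U i p \<partial>N \<omega>) \<in> borel_measurable M"
        by (rule borel_measurable_SUP[OF countableI_type U(2)])
      have "incseq (\<lambda>i \<omega>. \<integral>\<^sup>+ p. U i p \<partial>N \<omega>)"
        using \<open>incseq U\<close> by (auto simp: incseq_def le_fun_def intro!: nn_integral_mono)
      from nn_integral_monotone_convergence_SUP[OF this U(2)]
      show "(\<integral>\<^sup>+ \<omega>. (SUP i. \<integral>\<^sup>+ p. U i p \<partial>N \<omega>) \<partial>M) = (\<integral>\<^sup>+ p. (SUP i. U i p) \<partial>\<mu>)"
        by (simp only: U(3) nn_integral_monotone_convergence_SUP[OF \<open>incseq U\<close> U(1)])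
    qed
  qed
qed

section \<open>Left limits of the compensated jumps\<close>

text \<open>The strips increase to \<open>Z \<times> {0<..<T}\<close>, so a jump at time \<open>T\<close> itself is invisible to the left limit.\<close>

lemma set_integral_tendsto_at_left:
  fixes h :: "real \<times> real \<Rightarrow> real" and \<nu> :: "(real \<times> real) measure"
  assumes meas: "\<And>t. t < T \<Longrightarrow> Z \<times> {0<..t} \<in> sets \<nu>"
    and int: "set_integrable \<nu> (Z \<times> {0<..<T}) h"
  shows "((\<lambda>t. \<integral>p\<in>Z \<times> {0<..t}. h p \<partial>\<nu>) \<longlongrightarrow> (\<integral>p\<in>Z \<times> {0<..<T}. h p \<partial>\<nu>)) (at_left T)"
proof (rule tendsto_at_left_sequentially[of "T - 1"])
  fix S :: "nat \<Rightarrow> real"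
  assume S: "\<And>n. S n < T" "incseq S" "S \<longlonglongrightarrow> T"
  have "\<exists>n. s \<le> S n" if "s < T" for s
    using order_tendstoD(1)[OF S(3) that] by (auto simp: eventually_sequentially intro: less_imp_le)
  then have Un: "(\<Union>n. Z \<times> {0<..S n}) = Z \<times> {0<..<T}"
    using S(1) by (force intro: le_less_trans)
  have "(\<lambda>n. \<integral>p\<in>Z \<times> {0<..S n}. h p \<partial>\<nu>) \<longlonglongrightarrow> (\<integral>p\<in>(\<Union>n. Z \<times> {0<..S n}). h p \<partial>\<nu>)"
  proof (rule set_integral_cont_up)
    show "incseq (\<lambda>n. Z \<times> {0<..S n})"
      using S(2) by (force simp: incseq_def)
    show "set_integrable \<nu> (\<Union>n. Z \<times> {0<..S n}) h" using int Un by simp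
  qed (use meas S in auto)
  then show "(\<lambda>n. \<integral>p\<in>Z \<times> {0<..S n}. h p \<partial>\<nu>) \<longlonglongrightarrow> (\<integral>p\<in>Z \<times> {0<..<T}. h p \<partial>\<nu>)"
    by (simp add: Un)
qed simp

text \<open>By Campbell's formula the sum of all jumps before \<open>T\<close> has the mean \<open>max 0 T\<close> times the first
  moment of \<open>v\<close>, hence is almost surely finite. For such a realisation the compensated integral is a
  difference of two convergent integrals over increasing strips.\<close>

lemma compensated_jumps_left_limit:
  fixes v :: "real measure"
  assumes "prob_space M" and v: "sets v = sets (restrict_space borel {0<..})"
    and moment: "integrable v (\<lambda>z. z)"
    and N: "poisson_random_measure M (jump_time_intensity v) N"
  shows "AE \<omega> in M. \<exists>l. ((\<lambda>t. compensated_integral (jump_time_intensity v) (N \<omega>)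
           ({0<..} \<times> {0<..t}) (\<lambda>(z, s). z)) \<longlongrightarrow> l) (at_left T)"
proof -
  define \<mu> where "\<mu> = jump_time_intensity v"
  define S where "S = ({0<..} :: real set) \<times> {0<..<T}"
  define u :: "real \<times> real \<Rightarrow> real" where "u p = indicator S p *\<^sub>R (case p of (z, s) \<Rightarrow> z)" for p
  let ?leb = "restrict_space lborel {0::real<..}"
  interpret time: sigma_finite_measure ?leb
    by (rule sigma_finite_measure_restrict_space) (auto intro: sigma_finite_lborel)
  have \<mu>: "\<mu> = v \<Otimes>\<^sub>M ?leb" by (simp add: \<mu>_def jump_time_intensity_def)
  have "{0<..} \<in> sets v" by (simp add: v sets_restrict_space_iff)
  have strip: "{0<..} \<times> A \<in> sets \<mu>" if "A \<in> sets borel" "A \<subseteq> {0<..}" for A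
    unfolding \<mu> using \<open>{0<..} \<in> sets v\<close> that by (intro pair_measureI) (auto simp: sets_restrict_space_iff)
  have S: "S \<in> sets \<mu>" unfolding S_def by (rule strip) auto
  have id_v: "(\<lambda>z. z) \<in> borel_measurable v" using moment by auto
  have mark: "(\<lambda>(z, s). z) \<in> borel_measurable \<mu>"
    using measurable_compose[OF measurable_fst id_v] unfolding \<mu> by (simp add: split_beta')
  have u: "u \<in> borel_measurable \<mu>" unfolding u_def[abs_def] using mark S by measurable
  have u_nonneg: "0 \<le> u p" for p by (auto simp: u_def S_def indicator_def)
  have "(\<integral>\<^sup>+ p. u p \<partial>\<mu>) = (\<integral>\<^sup>+ z. \<integral>\<^sup>+ s. u (z, s) \<partial>?leb \<partial>v)"
    using u unfolding \<mu> by (subst time.nn_integral_fst) auto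
  also have "\<dots> \<le> (\<integral>\<^sup>+ z. ennreal \<bar>z\<bar> * emeasure lborel {0<..<T} \<partial>v)"
  proof (rule nn_integral_mono)
    fix z
    have "(\<integral>\<^sup>+ s. u (z, s) \<partial>?leb) \<le> (\<integral>\<^sup>+ s. ennreal \<bar>z\<bar> * indicator {0<..<T} s \<partial>?leb)"
      by (intro nn_integral_mono) (auto simp: u_def S_def indicator_def)
    also have "\<dots> = ennreal \<bar>z\<bar> * emeasure ?leb {0<..<T}"
      by (rule nn_integral_cmult_indicator) (auto simp: sets_restrict_space_iff)
    also have "emeasure ?leb {0<..<T} = emeasure lborel {0<..<T}"
      by (rule emeasure_restrict_space) auto
    finally show "(\<integral>\<^sup>+ s. u (z, s) \<partial>?leb) \<le> ennreal \<bar>z\<bar> * emeasure lborel {0<..<T}" .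
  qed
  also have "\<dots> = (\<integral>\<^sup>+ z. ennreal \<bar>z\<bar> \<partial>v) * emeasure lborel {0<..<T}"
    using id_v by (intro nn_integral_multc) auto
  also have "\<dots> < \<infinity>"
    using moment by (cases "0 < T") (auto simp: integrable_iff_bounded ennreal_mult_less_top)
  finally have u_finite: "(\<integral>\<^sup>+ p. u p \<partial>\<mu>) < \<infinity>" .
  have "integrable \<mu> u" by (rule integrableI_nonneg) (use u u_nonneg u_finite in auto)
  then have int_\<mu>: "set_integrable \<mu> S (\<lambda>(z, s). z)"
    by (simp add: set_integrable_def u_def[abs_def])
  have campbell: "(\<lambda>\<omega>. \<integral>\<^sup>+ p. u p \<partial>N \<omega>) \<in> borel_measurable M"
    "(\<integral>\<^sup>+ \<omega>. \<integral>\<^sup>+ p. u p \<partial>N \<omega> \<partial>M) = (\<integral>\<^sup>+ p. u p \<partial>\<mu>)"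
    using poisson_random_measure_campbell[OF assms(1) N[folded \<mu>_def], of u] u by auto
  have "AE \<omega> in M. (\<integral>\<^sup>+ p. u p \<partial>N \<omega>) \<noteq> \<infinity>"
    using campbell u_finite by (intro nn_integral_noteq_infinite) auto
  moreover have "AE \<omega> in M. sets (N \<omega>) = sets \<mu>"
    using N by (auto simp: poisson_random_measure_def \<mu>_def intro!: AE_I2)
  ultimately show ?thesis
  proof eventually_elim
    case (elim \<omega>)
    have "u \<in> borel_measurable (N \<omega>)" using u measurable_cong_sets[OF elim(2) refl] by auto
    then have "integrable (N \<omega>) u"
      by (rule integrableI_nonneg) (use elim(1) u_nonneg in \<open>auto simp: less_top\<close>)
    then have int_N: "set_integrable (N \<omega>) S (\<lambda>(z, s). z)"
      by (simp add: set_integrable_def u_def[abs_def])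
    have strip_\<mu>: "{0<..} \<times> {0<..t} \<in> sets \<mu>" for t by (rule strip) auto
    then have strip_N: "{0<..} \<times> {0<..t} \<in> sets (N \<omega>)" for t using elim(2) by simp
    show ?case
      unfolding compensated_integral_def \<mu>_def[symmetric]
      by (rule exI, rule tendsto_diff[OF
            set_integral_tendsto_at_left[OF strip_N int_N[unfolded S_def]]
            set_integral_tendsto_at_left[OF strip_\<mu> int_\<mu>[unfolded S_def]]])
  qed
qed

section \<open>Convergence of the bridge\<close>

theorem proposition2:
  fixes M :: "'w measure" and F :: "real \<Rightarrow> 'w measure"
    and N :: "'w \<Rightarrow> (real \<times> real) measure" and v :: "real measure"
    and X :: "real \<Rightarrow> 'w \<Rightarrow> real" and r x0 xhat :: real
  assumes "prob_space M"
    and "r > 0"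
    and "sets v = sets (restrict_space borel {0<..})"
    and "integrable v (\<lambda>z. z ^ 1)" and "integrable v (\<lambda>z. z ^ 2)"
    and "filtered_poisson_random_measure M F (jump_time_intensity v) N"
    and "jump_sde_solution M F (jump_time_intensity v) N 1
           (\<lambda>t x. - (r + coeff_A r t) * x - coeff_B r (jump_moment v 1) xhat t + jump_moment v 1)
           x0 X"
  shows "AE \<omega> in M. ((\<lambda>t. X t \<omega>) \<longlongrightarrow> xhat) (at_left 1)"
proof -
  define m where "m = jump_moment v 1"
  define L where "L \<omega> t = compensated_integral (jump_time_intensity v) (N \<omega>)
    ({0<..} \<times> {0<..t}) (\<lambda>(z, s). z)" for \<omega> t
  have "AE \<omega> in M. \<exists>l. (L \<omega> \<longlongrightarrow> l) (at_left 1)"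
    unfolding L_def using assms
    by (intro compensated_jumps_left_limit) (auto simp: filtered_poisson_random_measure_def)
  moreover have "AE \<omega> in M. cadlag_on_Ico 0 1 (\<lambda>t. X t \<omega>)"
    using assms(7) by (simp add: jump_sde_solution_def)
  moreover have "AE \<omega> in M. \<forall>t\<in>{0..<1}.
      set_integrable lborel {0..t} (\<lambda>s. - (r + coeff_A r s) * X s \<omega> - coeff_B r m xhat s + m) \<and>
      X t \<omega> = x0 + (\<integral>s\<in>{0..t}. (- (r + coeff_A r s) * X s \<omega> - coeff_B r m xhat s + m) \<partial>lborel) + L \<omega> t"
    using assms(7) unfolding jump_sde_solution_def L_def m_def by blast
  ultimately show ?thesis
  proof eventually_elim
    case (elim \<omega>)
    from elim(1) obtain l where "(L \<omega> \<longlongrightarrow> l) (at_left 1)" by blast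
    then show ?case
    proof (rule bridge_path_tendsto[OF \<open>r > 0\<close>, rotated -1])
      fix t :: real
      assume t: "t \<in> {0..<1}"
      show "((\<lambda>t. X t \<omega>) \<longlongrightarrow> X t \<omega>) (at_right t)"
        using elim(2) t unfolding cadlag_on_Ico_def by blast
      show "set_integrable lborel {0..t} (\<lambda>s. - (r + coeff_A r s) * X s \<omega> - coeff_B r m xhat s + m)"
        and "X t \<omega> = x0 + (\<integral>s\<in>{0..t}. (- (r + coeff_A r s) * X s \<omega> - coeff_B r m xhat s + m) \<partial>lborel) + L \<omega> t"
        using elim(3) t by blast+
    qed
  qed
qed

end
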